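(* Let $S$ be a numerical semigroup with conductor $c(S)$ and let $m\in\mathbb{N}$, $m\ge 1$, with $m \geq 2c(S)$. Let $\delta \in [0,c(S)]\cap S$ be an element that maximizes $\delta + 2n(\delta)$ over $[0,c(S)]\cap S$. Define $d := m-1+2c(S)-2n(\delta)$. Then $$D_A = D_B := \big([\delta, c(S)-1]\cap S\big)\ \cup\ [c(S), d-c(S)]\ \cup\ \big\{d-s : s\in [\delta,c(S)-1]\cap S\big\}$$ is an optimal solution to the AG matdot code problem (for $S$ and $m$), and its recovery threshold is $2(d-\delta)+1$.
   Context: $\mathbb{N}=\{0,1,2,\dots\}$. A numerical semigroup is a set $S\subseteq\mathbb{N}$ with $0\in S$, closed under addition, and with $\mathbb{N}\setminus S$ finite. For integers $a,b$, $[a,b]$ denotes the set of integers $x$ with $a\le x\le b$ (empty if $b<a$). The conductor is $c(S)=\min\{s\in S : \text{every integer } x\ge s \text{ lies in } S\}$. For $\delta\in[0,c(S)]\cap S$, $n(\delta):=|[\delta,c(S)-1]\cap S|$. Given $m\ge 1$, a pair of sets $D_A,D_B\subseteq S$ is a solution to the AG matdot code problem (for $S$ and $m$) if $|D_A|=|D_B|=m$ and there exists $d\in D_A+D_B$ such that there are exactly $m$ pairs $(a,b)\in D_A\times D_B$ with $a+b=d$ (equivalently $D_B=\{d-a : a\in D_A\}$). Its recovery threshold is $\max(D_A)+\max(D_B)+1$. A solution is optimal if its recovery threshold is minimum among all solutions for the same $S$ and $m$ (the number $d$ is not fixed). *)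

theory Defs
  imports Main "HOL-Library.Set_Algebras"
begin

definition numerical_semigroup :: "nat set \<Rightarrow> bool" where
  "numerical_semigroup S \<longleftrightarrow>
     0 \<in> S \<and> (\<forall>x\<in>S. \<forall>y\<in>S. x + y \<in> S) \<and> finite (UNIV - S)"

definition conductor :: "nat set \<Rightarrow> nat" where
  "conductor S = (LEAST s. s \<in> S \<and> (\<forall>x\<ge>s. x \<in> S))"

text \<open>
  The integer interval \<open>[\<delta>, c(S) - 1]\<close> is written \<open>{\<delta>..<conductor S}\<close>:
  on natural numbers \<open>{\<delta>..conductor S - 1}\<close> would wrongly be nonempty for
  \<open>\<delta> = conductor S = 0\<close>.
\<close>

definition left_count :: "nat set \<Rightarrow> nat \<Rightarrow> nat" where
  "left_count S \<delta> = card ({\<delta>..<conductor S} \<inter> S)"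

text \<open>
  \<open>A + B\<close> is the sumset. The notion is meant for \<open>m \<ge> 1\<close>, where the
  cardinality conditions force \<open>A\<close> and \<open>B\<close> to be finite and nonempty.
\<close>

definition matdot_solution :: "nat set \<Rightarrow> nat \<Rightarrow> nat set \<Rightarrow> nat set \<Rightarrow> bool" where
  "matdot_solution S m A B \<longleftrightarrow>
     A \<subseteq> S \<and> B \<subseteq> S \<and> card A = m \<and> card B = m \<and>
     (\<exists>d \<in> A + B. card {(a, b). a \<in> A \<and> b \<in> B \<and> a + b = d} = m)"

definition recovery_threshold :: "nat set \<Rightarrow> nat set \<Rightarrow> nat" where
  "recovery_threshold A B = Max A + Max B + 1"

definition optimal_matdot_solution :: "nat set \<Rightarrow> nat \<Rightarrow> nat set \<Rightarrow> nat set \<Rightarrow> bool" where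
  "optimal_matdot_solution S m A B \<longleftrightarrow>
     matdot_solution S m A B \<and>
     (\<forall>A' B'. matdot_solution S m A' B' \<longrightarrow>
        recovery_threshold A B \<le> recovery_threshold A' B')"

end

theory Submission
  imports Defs
begin

text \<open>
  Write \<open>c\<close> for the conductor and \<open>n\<close> for \<open>left_count S\<close>. In a solution \<open>A, B\<close> with
  \<open>B = d - A\<close>, put \<open>a = Min A\<close> and \<open>b = Min B\<close>, so that the threshold is \<open>2 d - a - b + 1\<close>.
  An element of \<open>A\<close> lies below \<open>c\<close>, or is the reflection \<open>d - s\<close> of some \<open>s \<in> B\<close> below \<open>c\<close>,
  or lies in \<open>[max a c, d - max b c]\<close>. Hence
  \<open>m \<le> n(a) + n(b) + d + 1 - max a c - max b c\<close>, where the hypothesis on \<open>m\<close> ensures that the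
  interval is nonempty. So the threshold is at least \<open>2 m - 1 + h(a) + h(b)\<close> with
  \<open>h(x) = 2 max x c - x - 2 n(x)\<close>, and \<open>h(x) \<ge> 2 c - (\<delta> + 2 n(\<delta>))\<close> for every \<open>x \<in> S\<close>,
  by the choice of \<open>\<delta>\<close> (compared with \<open>c\<close> itself when \<open>x > c\<close>).
\<close>

lemma conductor_mem_and_above:
  assumes "numerical_semigroup S"
  shows "conductor S \<in> S \<and> (\<forall>x\<ge>conductor S. x \<in> S)"
proof -
  have "finite (UNIV - S)"
    using assms by (simp add: numerical_semigroup_def)
  then obtain k where k: "\<forall>x\<in>UNIV - S. x < k"
    using finite_nat_set_iff_bounded by blast
  then have "x \<in> S" if "x \<ge> k" for x
    using that leD[of k x] by blast
  then have "k \<in> S \<and> (\<forall>x\<ge>k. x \<in> S)"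
    by simp
  then show ?thesis
    unfolding conductor_def by (rule LeastI)
qed

lemma conductor_pred_notin:
  assumes "numerical_semigroup S" and "conductor S > 0"
  shows "conductor S - 1 \<notin> S"
proof
  assume pred: "conductor S - 1 \<in> S"
  have "x \<in> S" if "x \<ge> conductor S - 1" for x
  proof (cases "x = conductor S - 1")
    case False
    then have "x \<ge> conductor S" using that by linarith
    then show ?thesis using conductor_mem_and_above[OF assms(1)] by blast
  qed (use pred in simp)
  then have "conductor S \<le> conductor S - 1"
    using pred by (subst (1) conductor_def) (blast intro: Least_le)
  then show False
    using assms(2) by simp
qed

text \<open>For a positive conductor, \<open>conductor S - 1\<close> is a gap. This saves one over
  the trivial bound \<open>conductor S\<close>, and that one makes
  \<open>two_left_count_less\<close> strict even when \<open>m = 2 * conductor S\<close>.\<close>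

lemma left_count_le_pred:
  assumes "numerical_semigroup S"
  shows "left_count S x \<le> conductor S - 1"
proof (cases "conductor S = 0")
  case True
  then show ?thesis by (simp add: left_count_def)
next
  case False
  have "{x..<conductor S} \<inter> S \<subseteq> {..<conductor S - 1}"
  proof
    fix y assume y: "y \<in> {x..<conductor S} \<inter> S"
    then have "y \<noteq> conductor S - 1"
      using conductor_pred_notin[OF assms] False by auto
    with y show "y \<in> {..<conductor S - 1}" by auto
  qed
  then have "card ({x..<conductor S} \<inter> S) \<le> card {..<conductor S - 1}"
    by (intro card_mono) auto
  then show ?thesis by (simp add: left_count_def)
qed

lemma two_left_count_less:
  assumes "numerical_semigroup S" and "m \<ge> 1" and "m \<ge> 2 * conductor S"
  shows "2 * left_count S x < m"
  using left_count_le_pred[OF assms(1), of x] assms(2,3) by linarith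

lemma left_count_eq_0: "conductor S \<le> x \<Longrightarrow> left_count S x = 0"
  by (simp add: left_count_def)

text \<open>For fixed \<open>d\<close>, either entry of a pair determines the other, so both
  projections are injective on the \<open>m\<close> pairs. Their images therefore exhaust the
  \<open>m\<close>-element sets \<open>A\<close> and \<open>B\<close>.\<close>

lemma matdot_solution_reflection:
  assumes sol: "matdot_solution S m A B" and m: "m \<ge> 1"
  obtains d where "\<And>a. a \<in> A \<Longrightarrow> a \<le> d \<and> d - a \<in> B"
    and "\<And>b. b \<in> B \<Longrightarrow> b \<le> d \<and> d - b \<in> A"
proof -
  obtain d where card: "card {(a, b). a \<in> A \<and> b \<in> B \<and> a + b = d} = m"
    using sol by (auto simp: matdot_solution_def)
  define P where "P = {(a, b). a \<in> A \<and> b \<in> B \<and> a + b = d}"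
  have cards: "card A = m" "card B = m"
    using sol by (auto simp: matdot_solution_def)
  then have fin: "finite A" "finite B"
    using m by (auto intro: card_ge_0_finite)
  have "card (fst ` P) = m" "card (snd ` P) = m"
    using card by (auto simp: P_def card_image inj_on_def)
  moreover have "fst ` P \<subseteq> A" "snd ` P \<subseteq> B"
    by (auto simp: P_def)
  ultimately have "fst ` P = A" "snd ` P = B"
    using fin cards by (metis card_subset_eq)+
  then have "\<And>a. a \<in> A \<Longrightarrow> a \<in> fst ` P" "\<And>b. b \<in> B \<Longrightarrow> b \<in> snd ` P"
    by simp_all
  then show thesis
    by (intro that[of d]) (force simp: P_def)+
qed

lemma card_reflected_le:
  fixes S A B :: "nat set"
  assumes "A \<subseteq> S" and "B \<subseteq> S"
    and "\<And>x. x \<in> A \<Longrightarrow> a \<le> x \<and> x \<le> d \<and> d - x \<in> B" and "\<And>y. y \<in> B \<Longrightarrow> b \<le> y"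
  shows "card A \<le> left_count S a + left_count S b
           + (d + 1 - (max a (conductor S) + max b (conductor S)))"
proof -
  define c where "c = conductor S"
  define L where "L = {a..<c} \<inter> S"
  \<comment> \<open>The half-open form makes the cardinality formula with truncated subtraction
    correct even when the interval is empty.\<close>
  define M where "M = {max a c..<d + 1 - max b c}"
  define R where "R = (\<lambda>s. d - s) ` ({b..<c} \<inter> S)"
  have "A \<subseteq> L \<union> M \<union> R"
  proof
    fix x assume x: "x \<in> A"
    have 1: "a \<le> x" "x \<le> d" "d - x \<in> B" "x \<in> S" "d - x \<in> S" "b \<le> d - x"
      using assms x by blast+
    consider "x < c" | "d - x < c" | "c \<le> x" "c \<le> d - x"
      by linarith
    then show "x \<in> L \<union> M \<union> R"
    proof cases
      case 1
      then show ?thesis using \<open>a \<le> x\<close> \<open>x \<in> S\<close> by (auto simp: L_def)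
    next
      case 2
      then have "d - x \<in> {b..<c} \<inter> S" using 1 by auto
      moreover have "x = d - (d - x)" using 1 by simp
      ultimately show ?thesis unfolding R_def by blast
    next
      case 3
      then show ?thesis using 1 by (auto simp: M_def)
    qed
  qed
  then have "card A \<le> card (L \<union> M \<union> R)"
    by (intro card_mono) (auto simp: L_def M_def R_def)
  also have "\<dots> \<le> card L + card M + card R"
    using card_Un_le[of "L \<union> M" R] card_Un_le[of L M] by linarith
  also have "card R \<le> left_count S b"
    unfolding R_def left_count_def c_def by (intro card_image_le) auto
  also have "card L = left_count S a"
    by (simp add: L_def left_count_def c_def)
  also have "card M = d + 1 - (max a c + max b c)"
    by (simp add: M_def)
  finally show ?thesis by (simp add: c_def)
qed

text \<open>The bound is 2 m - 1 + 2 (2 c - F), with every subtraction moved to the other side to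
  avoid truncation.\<close>

lemma recovery_threshold_lower_bound:
  assumes S: "numerical_semigroup S"
    and m: "m \<ge> 1" "m \<ge> 2 * conductor S"
    and F: "\<forall>x \<in> {0..conductor S} \<inter> S. x + 2 * left_count S x \<le> F"
    and sol: "matdot_solution S m A B"
  shows "2 * m + 4 * conductor S \<le> recovery_threshold A B + 1 + 2 * F"
proof -
  obtain d where dA: "\<And>a. a \<in> A \<Longrightarrow> a \<le> d \<and> d - a \<in> B"
    and dB: "\<And>b. b \<in> B \<Longrightarrow> b \<le> d \<and> d - b \<in> A"
    by (rule matdot_solution_reflection[OF sol m(1)]) (rule that)
  have sub: "A \<subseteq> S" "B \<subseteq> S" and cards: "card A = m" "card B = m"
    using sol by (auto simp: matdot_solution_def)
  have fin: "finite A" "finite B"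
    using cards m by (auto intro: card_ge_0_finite)
  have ne: "A \<noteq> {}" "B \<noteq> {}"
    using cards m by auto
  define c where "c = conductor S"
  define a where "a = Min A"
  define b where "b = Min B"
  define u where "u = max a c"
  define v where "v = max b c"
  have ab: "a \<in> A" "b \<in> B"
    using fin ne by (auto simp: a_def b_def)
  have "m \<le> left_count S a + left_count S b + (d + 1 - (u + v))"
    unfolding cards(1)[symmetric] c_def u_def v_def
    using sub dA fin by (intro card_reflected_le[where B = B]) (simp_all add: a_def b_def)
  \<comment> \<open>Adding 2 n(a) < m and 2 n(b) < m gives n(a) + n(b) < m, so the truncated
    difference is positive and may be read as an integer difference.\<close>
  then have count: "m + u + v \<le> left_count S a + left_count S b + d + 1"
    using two_left_count_less[OF S m, of a] two_left_count_less[OF S m, of b] by linarith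
  \<comment> \<open>This is h(x) \<ge> 2 c - F. Beyond \<open>c\<close> the count vanishes, so h(x)
    = x > c, while the choice of \<open>c\<close> in \<open>F\<close> gives F \<ge> c.\<close>
  have h: "2 * c + x + 2 * left_count S x \<le> F + 2 * max x c" if "x \<in> S" for x
  proof (cases "x \<le> c")
    case True
    then show ?thesis using F[rule_format, of x] that by (auto simp: c_def max_def)
  next
    case False
    then show ?thesis
      using F[rule_format, of c] conductor_mem_and_above[OF S]
      by (auto simp: c_def left_count_eq_0 max_def)
  qed
  have "d - b \<le> Max A" "d - a \<le> Max B"
    using dA dB ab fin by auto
  moreover have "a \<in> S" "b \<in> S"
    using ab sub by auto
  moreover have "a \<le> d" "b \<le> d"
    using dA[OF ab(1)] dB[OF ab(2)] by simp_all
  ultimately show ?thesis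
    using h[of a, folded u_def] h[of b, folded v_def] count
    unfolding recovery_threshold_def c_def by linarith
qed

theorem mainTheorem1:
  fixes S :: "nat set" and m \<delta> d :: nat and D :: "nat set"
  assumes "numerical_semigroup S"
    and "m \<ge> 1"
    and "m \<ge> 2 * conductor S"
    and "\<delta> \<in> {0..conductor S} \<inter> S"
    and "\<forall>x \<in> {0..conductor S} \<inter> S. x + 2 * left_count S x \<le> \<delta> + 2 * left_count S \<delta>"
    and "d = m - 1 + 2 * conductor S - 2 * left_count S \<delta>"
    and "D = ({\<delta>..<conductor S} \<inter> S) \<union> {conductor S..d - conductor S} \<union>
             {d - s |s. s \<in> {\<delta>..<conductor S} \<inter> S}"
  shows "optimal_matdot_solution S m D D \<and> recovery_threshold D D = 2 * (d - \<delta>) + 1"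
proof -
  define c where "c = conductor S"
  define n where "n = left_count S \<delta>"
  define L where "L = {\<delta>..<c} \<inter> S"
  define R where "R = (\<lambda>s. d - s) ` L"
  have above: "x \<in> S" if "x \<ge> c" for x
    using that conductor_mem_and_above[OF assms(1)] by (simp add: c_def)
  have n: "2 * n < m"
    using two_left_count_less[OF assms(1-3)] by (simp add: n_def)
  have \<delta>: "\<delta> \<in> S" "\<delta> \<le> c"
    using assms(4) by (auto simp: c_def)
  \<comment> \<open>The value of \<open>d\<close> is forced by counting: n + (d - 2 c + 1) + n = m
    for the left part, the middle interval and the reflected part.\<close>
  have d: "d + 1 + 2 * n = m + 2 * c"
    using assms(6) n by (simp add: c_def n_def)
  \<comment> \<open>Hence c \<le> d - c, which separates the three parts: \<open>L\<close> lies
    below \<open>c\<close>, and its reflection \<open>R\<close> lies above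
    \<open>d - c\<close>.\<close>
  then have d_ge: "2 * c \<le> d"
    using n by linarith
  have D: "D = L \<union> {c..d - c} \<union> R"
    unfolding assms(7) L_def R_def c_def by blast
  have bounds: "x \<le> d \<and> x \<le> d - \<delta>" if "x \<in> D" for x
    using that \<delta> d_ge by (auto simp: D L_def R_def)
  have finD: "finite D"
    by (simp add: D L_def R_def)
  have symm: "d - x \<in> D" if x: "x \<in> D" for x
  proof -
    consider "x \<in> L" | "x \<in> {c..d - c}" | s where "s \<in> L" "x = d - s"
      using x unfolding D R_def by blast
    then show ?thesis
    proof cases
      case 1
      then show ?thesis by (auto simp: D R_def)
    next
      case 2
      then have "d - x \<in> {c..d - c}" using d_ge by auto
      then show ?thesis by (simp add: D)
    next
      case 3
      then have "d - x = s" using d_ge by (auto simp: L_def)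
      then show ?thesis using 3 by (simp add: D)
    qed
  qed
  have "card D = m"
  proof -
    have inj: "inj_on (\<lambda>s. d - s) L"
      using d_ge by (auto simp: inj_on_def L_def)
    have "card R = n" "card L = n"
      unfolding R_def card_image[OF inj] by (simp_all add: L_def n_def left_count_def c_def)
    moreover have "card (L \<union> {c..d - c}) = card L + card {c..d - c}"
      by (rule card_Un_disjoint) (auto simp: L_def)
    moreover have "card (L \<union> {c..d - c} \<union> R) = card (L \<union> {c..d - c}) + card R"
      using d_ge by (intro card_Un_disjoint) (auto simp: L_def R_def)
    moreover have "card {c..d - c} + 2 * n = m"
      using d d_ge by simp
    ultimately show ?thesis by (simp add: D)
  qed
  \<comment> \<open>Reflection need not preserve \<open>S\<close>, but here it lands at or beyond
    the conductor.\<close>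
  moreover have "c \<le> d - s" if "s \<in> L" for s
    using that d_ge by (auto simp: L_def)
  then have "D \<subseteq> S"
    by (auto simp: D R_def L_def intro!: above)
  \<comment> \<open>If \<delta> = c, then \<open>L\<close> is empty and \<delta> is the left end of
    the nonempty middle interval.\<close>
  moreover have "\<delta> \<in> D"
    using \<delta> d_ge by (cases "\<delta> = c") (auto simp: D L_def)
  moreover have "{(a, b). a \<in> D \<and> b \<in> D \<and> a + b = d} = (\<lambda>x. (x, d - x)) ` D"
  proof (intro set_eqI iffI)
    fix p assume "p \<in> (\<lambda>x. (x, d - x)) ` D"
    then obtain x where "x \<in> D" "p = (x, d - x)" by blast
    then show "p \<in> {(a, b). a \<in> D \<and> b \<in> D \<and> a + b = d}"
      using symm[of x] bounds[of x] by simp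
  qed auto
  then have "card {(a, b). a \<in> D \<and> b \<in> D \<and> a + b = d} = card D"
    by (simp add: card_image inj_on_def)
  moreover have "d \<in> D + D"
    using set_plus_intro[OF \<open>\<delta> \<in> D\<close> symm[OF \<open>\<delta> \<in> D\<close>]] \<delta> d_ge by simp
  ultimately have sol: "matdot_solution S m D D"
    unfolding matdot_solution_def by auto
  have "Max D = d - \<delta>"
    using finD bounds symm[OF \<open>\<delta> \<in> D\<close>] by (intro Max_eqI) auto
  then have thr: "recovery_threshold D D = 2 * (d - \<delta>) + 1"
    by (simp add: recovery_threshold_def)
  \<comment> \<open>With F = \<delta> + 2 n and m + 2 c = d + 1 + 2 n, the lower bound becomes
    exactly the threshold of \<open>D\<close>.\<close>
  moreover have "2 * (d - \<delta>) + 1 \<le> recovery_threshold A B"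
    if "matdot_solution S m A B" for A B
    using recovery_threshold_lower_bound[OF assms(1-3) assms(5) that] d \<delta> d_ge
    unfolding c_def n_def by arith
  ultimately show ?thesis
    using sol by (simp add: optimal_matdot_solution_def)
qed

end
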